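(* Let $p\in\mathcal{H}_1$. (i) Let $\Omega\subsetneq\mathbb{C}$ and let $\psi\in\Psi(q_\varrho)$ (with respect to $\Omega$). If $\psi(p(z),zp'(z),z^2p''(z);z)\in\Omega$ for all $z\in\mathbb{D}$, then $p(z)\prec\cosh\sqrt z$. (ii) Let $\psi\in\Psi(q_\varrho)$ with $\Omega=\Omega_\varrho$. If $\psi(p(z),zp'(z),z^2p''(z);z)\prec\cosh\sqrt z$, then $p(z)\prec\cosh\sqrt z$.
   Context: $\mathbb{D}=\{z\in\mathbb{C}:|z|<1\}$. For analytic functions $f,g$ on $\mathbb{D}$, $f\prec g$ means that $f(z)=g(w(z))$ for some analytic $w:\mathbb{D}\to\mathbb{D}$ with $w(0)=0$. The function $\cosh\sqrt z$ denotes the analytic function $\sum_{n=0}^\infty z^n/(2n)!$, and $\Omega_\varrho=\{\omega\in\mathbb{C}:|\log(\omega+\sqrt{\omega^2-1})|^2<1\}$ (principal branches) is the image of $\mathbb{D}$ under $\cosh\sqrt z$. $\mathcal{H}_1=\mathcal{H}[1,1]$ is the class of analytic functions on $\mathbb{D}$ of the form $p(z)=1+a_1z+a_2z^2+\cdots$. Given $\Omega\subsetneq\mathbb{C}$, $\Psi(q_\varrho)$ is the class of functions $\psi:\mathbb{C}^3\times\mathbb{D}\to\mathbb{C}$ such that $\psi(r,s,t;z)\notin\Omega$ whenever $z\in\mathbb{D}$ and there exist $\xi$ with $|\xi|=1$ and $m\ge 1$ such that $$r=\cosh\sqrt\xi,\qquad s=\frac m2\sqrt\xi\,\sinh\sqrt\xi,\qquad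 \operatorname{Re}\left(1+\frac ts\right)\ge\frac m2(1+\cot 1).$$ In (ii), as usual for a subordination, $\psi(p(z),zp'(z),z^2p''(z);z)$ is understood to be analytic in $\mathbb{D}$. *)

theory Defs
  imports "HOL-Complex_Analysis.Complex_Analysis"
begin

abbreviation unit_disc :: "complex set" (\<open>\<D>\<close>) where
  "\<D> \<equiv> ball 0 1"

definition subordinate :: "(complex \<Rightarrow> complex) \<Rightarrow> (complex \<Rightarrow> complex) \<Rightarrow> bool"
  (infix \<open>\<prec>\<^sub>\<D>\<close> 50) where
  "f \<prec>\<^sub>\<D> g \<longleftrightarrow> f holomorphic_on \<D> \<and> g holomorphic_on \<D> \<and>
     (\<exists>w. w holomorphic_on \<D> \<and> w ` \<D> \<subseteq> \<D> \<and> w 0 = 0 \<and> (\<forall>z\<in>\<D>. f z = g (w z)))"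

definition cosh_sqrt :: "complex \<Rightarrow> complex" where
  "cosh_sqrt z = (\<Sum>n. z ^ n / fact (2 * n))"

definition \<Omega>\<^sub>\<rho> :: "complex set" where
  "\<Omega>\<^sub>\<rho> = {\<omega>. (cmod (Ln (\<omega> + csqrt (\<omega>\<^sup>2 - 1))))\<^sup>2 < 1}"

definition \<H>\<^sub>1 :: "(complex \<Rightarrow> complex) set" where
  "\<H>\<^sub>1 = {p. p holomorphic_on \<D> \<and>
          (\<exists>a. a 0 = 1 \<and> (\<forall>z\<in>\<D>. (\<lambda>n. a n * z ^ n) sums p z))}"

text \<open>
  The admissible functions for \<open>cosh_sqrt\<close> with respect to \<open>\<Omega>\<close>. The number \<open>m\<close> is real. The
  expression \<open>csqrt \<xi> * sinh (csqrt \<xi>)\<close> does not depend on the branch of the square root, and it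
  does not vanish for \<open>cmod \<xi> = 1\<close>, so \<open>t / s\<close> is always a genuine quotient. Only the values of
  \<open>\<psi>\<close> at points whose last coordinate lies in the unit disc matter.
\<close>
definition admissible ::
  "complex set \<Rightarrow> (complex \<Rightarrow> complex \<Rightarrow> complex \<Rightarrow> complex \<Rightarrow> complex) set" where
  "admissible \<Omega> = {\<psi>. \<forall>r s t. \<forall>z\<in>\<D>.
     (\<exists>(\<xi>::complex) (m::real). cmod \<xi> = 1 \<and> m \<ge> 1 \<and>
        r = cosh_sqrt \<xi> \<and>
        s = of_real (m / 2) * csqrt \<xi> * sinh (csqrt \<xi>) \<and>
        Re (1 + t / s) \<ge> m / 2 * (1 + cot 1))
     \<longrightarrow> \<psi> r s t z \<notin> \<Omega>}"

lemma cosh_sqrt_sums: "(\<lambda>n. z ^ n / fact (2 * n)) sums cosh (csqrt z)"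
proof -
  have "(\<lambda>n. if even n then csqrt z ^ n /\<^sub>R fact n else 0) sums cosh (csqrt z)"
    by (rule cosh_converges)
  moreover have "strict_mono (\<lambda>n::nat. 2 * n)"
    by (simp add: strict_mono_def)
  ultimately have "(\<lambda>n. csqrt z ^ (2 * n) /\<^sub>R fact (2 * n)) sums cosh (csqrt z)"
    by (subst (asm) sums_mono_reindex [symmetric, where g = "\<lambda>n. 2 * n"]) (auto elim: evenE)
  thus ?thesis
    unfolding power_mult power2_csqrt by (simp add: scaleR_conv_of_real field_simps)
qed

lemma cosh_sqrt_eq: "cosh_sqrt z = cosh (csqrt z)"
  using cosh_sqrt_sums [of z] unfolding cosh_sqrt_def by (simp add: sums_iff)

lemma cosh_sqrt_power2: "cosh_sqrt (u\<^sup>2) = cosh u"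
proof -
  have "csqrt (u\<^sup>2) = u \<or> csqrt (u\<^sup>2) = - u"
    by (metis power2_csqrt power2_eq_iff)
  thus ?thesis
    by (auto simp: cosh_sqrt_eq)
qed

lemma \<Omega>\<^sub>\<rho>_eq_image: "\<Omega>\<^sub>\<rho> = cosh_sqrt ` \<D>"
proof (intro equalityI subsetI)
  fix \<omega> assume \<omega>: "\<omega> \<in> \<Omega>\<^sub>\<rho>"
  define c where "c = csqrt (\<omega>\<^sup>2 - 1)"
  define u where "u = Ln (\<omega> + c)"
  have c2: "c\<^sup>2 = \<omega>\<^sup>2 - 1"
    by (simp add: c_def)
  hence prod: "(\<omega> + c) * (\<omega> - c) = 1"
    by (simp add: power2_eq_square algebra_simps)
  hence nz: "\<omega> + c \<noteq> 0"
    by auto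
  have e: "exp u = \<omega> + c"
    using nz by (simp add: u_def)
  have "exp (- u) = \<omega> - c"
    using prod e nz by (simp add: exp_minus field_simps)
  with e have "cosh u = \<omega>"
    by (simp add: cosh_field_def)
  moreover have "u\<^sup>2 \<in> \<D>"
    using \<omega> by (simp add: \<Omega>\<^sub>\<rho>_def u_def c_def norm_power)
  ultimately show "\<omega> \<in> cosh_sqrt ` \<D>"
    using cosh_sqrt_power2 [of u] by (metis imageI)
next
  fix \<omega> assume "\<omega> \<in> cosh_sqrt ` \<D>"
  then obtain z where z: "cmod z < 1" "\<omega> = cosh_sqrt z"
    by auto
  define v where "v = csqrt z"
  have v2: "v\<^sup>2 = z" and \<omega>: "\<omega> = cosh v"
    using z by (auto simp: v_def cosh_sqrt_eq)
  have v1: "(cmod v)\<^sup>2 < 1"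
    using z v2 by (metis norm_power)
  hence "cmod v < 1"
    by (simp add: power_less_one_iff)
  hence "\<bar>Im v\<bar> < 1"
    using abs_Im_le_cmod [of v] by linarith
  hence im: "\<bar>Im v\<bar> < pi"
    using pi_gt3 by linarith
  have "(csqrt (\<omega>\<^sup>2 - 1))\<^sup>2 = (sinh v)\<^sup>2"
    by (simp add: \<omega> cosh_square_eq)
  hence "csqrt (\<omega>\<^sup>2 - 1) = sinh v \<or> csqrt (\<omega>\<^sup>2 - 1) = - sinh v"
    by (rule power2_eq_iff [THEN iffD1])
  hence "\<omega> + csqrt (\<omega>\<^sup>2 - 1) = exp v \<or> \<omega> + csqrt (\<omega>\<^sup>2 - 1) = exp (- v)"
    using cosh_plus_sinh [of v] cosh_minus_sinh [of v] by (auto simp: \<omega>)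
  hence "Ln (\<omega> + csqrt (\<omega>\<^sup>2 - 1)) = v \<or> Ln (\<omega> + csqrt (\<omega>\<^sup>2 - 1)) = - v"
    using im by (smt (verit) Ln_exp uminus_complex.simps(2))
  hence "cmod (Ln (\<omega> + csqrt (\<omega>\<^sup>2 - 1))) = cmod v"
    by auto
  thus "\<omega> \<in> \<Omega>\<^sub>\<rho>"
    using v1 by (simp add: \<Omega>\<^sub>\<rho>_def)
qed

lemma \<H>\<^sub>1_iff: "p \<in> \<H>\<^sub>1 \<longleftrightarrow> p holomorphic_on \<D> \<and> p 0 = 1"
proof
  assume "p \<in> \<H>\<^sub>1"
  then obtain a where a: "p holomorphic_on \<D>" "a 0 = 1"
      "\<And>z. z \<in> \<D> \<Longrightarrow> (\<lambda>n. a n * z ^ n) sums p z"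
    by (auto simp: \<H>\<^sub>1_def)
  have "(\<lambda>n. a n * 0 ^ n) sums p 0"
    by (rule a(3)) simp
  with a(1,2) show "p holomorphic_on \<D> \<and> p 0 = 1"
    by simp
next
  assume p: "p holomorphic_on \<D> \<and> p 0 = 1"
  have "(\<lambda>n. (deriv ^^ n) p 0 / fact n * z ^ n) sums p z" if "z \<in> \<D>" for z
    using holomorphic_power_series [of p 0 1 z] p that by simp
  with p show "p \<in> \<H>\<^sub>1"
    unfolding \<H>\<^sub>1_def by (intro CollectI conjI exI [of _ "\<lambda>n. (deriv ^^ n) p 0 / fact n"]) auto
qed

end

theory Submission
  imports Defs
begin

text \<open>
  The proof follows Miller and Mocanu. The function \<open>q = cosh_sqrt\<close> is univalent on a disc larger
  than the closed unit disc, so if \<open>p\<close> leaves \<open>q ` \<D>\<close>, then at a point \<open>z\<^sub>0\<close> of minimal modulus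
  where it does, \<open>w = q\<inverse> \<circ> p\<close> is holomorphic near \<open>cball 0 (cmod z\<^sub>0)\<close> and attains its maximum
  modulus \<open>1\<close> there. Jack's lemma for \<open>w\<close> shows that \<open>p\<close> satisfies the
  admissibility conditions at \<open>z\<^sub>0\<close>, with \<open>\<xi> = w z\<^sub>0\<close>, up to the inequality
  \<open>Re (v * cosh v / sinh v) \<ge> cot 1\<close> for \<open>cmod v = 1\<close>. The latter says that
  \<open>Re (1 + \<xi> * q'' \<xi> / q' \<xi>)\<close> is smallest on the unit circle at \<open>\<xi> = -1\<close>.
\<close>

section \<open>Jack's lemma\<close>

text \<open>If \<open>D > 0\<close>, then \<open>f'\<close> is positive just to the right of the
  critical point \<open>a\<close>, and the mean value theorem puts a value of \<open>f\<close> above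
  \<open>f a\<close>.\<close>

lemma second_deriv_le_at_global_max:
  fixes f f' :: "real \<Rightarrow> real"
  assumes f: "\<And>x. (f has_real_derivative f' x) (at x)"
    and f': "(f' has_real_derivative D) (at a)"
    and max: "\<And>x. f x \<le> f a"
  shows "f' a = 0" "D \<le> 0"
proof -
  show f'a: "f' a = 0"
    using DERIV_local_max [OF f, of 1 a] max by auto
  show "D \<le> 0"
  proof (rule ccontr)
    assume "\<not> D \<le> 0"
    then obtain d where d: "d > 0" "\<And>h. 0 < h \<Longrightarrow> h < d \<Longrightarrow> f' a < f' (a + h)"
      using DERIV_pos_inc_right [OF f'] by auto
    obtain x where x: "a < x" "x < a + d / 2" "f (a + d / 2) - f a = (a + d / 2 - a) * f' x"
      using MVT2 [of a "a + d / 2" f f'] f d(1) by auto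
    have "f' x > 0"
      using d(2) [of "x - a"] x d(1) f'a by auto
    hence "f (a + d / 2) - f a > 0"
      using x(3) d(1) by (metis add_diff_cancel_left' half_gt_zero mult_pos_pos)
    with max [of "a + d / 2"] show False
      by simp
  qed
qed

text \<open>The function t \<mapsto> |w(z0 exp(it))|^2 is maximal at t = 0. The vanishing first
  derivative makes z0 w'(z0) / w(z0) a real number m, and the sign of the second derivative gives
  the final inequality. The bound m \<ge> 1 comes from the Schwarz lemma along the radius to
  \<open>z0\<close>.\<close>

lemma Jack_lemma:
  fixes w :: "complex \<Rightarrow> complex"
  assumes w: "w holomorphic_on U" and U: "open U" "cball 0 (cmod z0) \<subseteq> U"
    and w0: "w 0 = 0" and z0: "z0 \<noteq> 0"
    and le1: "\<And>z. cmod z < cmod z0 \<Longrightarrow> cmod (w z) < 1"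
    and eq1: "cmod (w z0) = 1"
  obtains m :: real where "m \<ge> 1" "z0 * deriv w z0 = of_real m * w z0"
    "m \<le> Re (1 + z0 * deriv (deriv w) z0 / deriv w z0)"
proof -
  define \<xi> where "\<xi> = w z0"
  define A where "A = z0 * deriv w z0"
  define B where "B = z0\<^sup>2 * deriv (deriv w) z0"
  define e where "e = (\<lambda>t. z0 * exp (\<i> * of_real t))"
  have xi: "cmod \<xi> = 1" "cnj \<xi> * \<xi> = 1"
    using eq1 by (auto simp: \<xi>_def complex_norm_square [symmetric] mult.commute)
  have inU: "z \<in> U" if "cmod z \<le> cmod z0" for z
    using U(2) that by auto
  have e: "cmod (e t) = cmod z0" for t
    by (simp add: e_def norm_mult)
  have e': "(e has_vector_derivative \<i> * e t) (at t)" for t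
    unfolding e_def by (auto intro!: derivative_eq_intros has_vector_derivative_real_field)
  have w': "(w has_field_derivative deriv w z) (at z)" if "z \<in> U" for z
    using holomorphic_derivI [OF w U(1) that] .
  have w'': "(deriv w has_field_derivative deriv (deriv w) z) (at z)" if "z \<in> U" for z
    using holomorphic_derivI [OF holomorphic_deriv [OF w U(1)] U(1) that] .
  define G where "G = (\<lambda>t. w (e t))"
  define G' where "G' = (\<lambda>t. \<i> * e t * deriv w (e t))"
  have G: "(G has_vector_derivative G' t) (at t)" for t
    unfolding G_def G'_def
    using field_vector_diff_chain_at [OF e' w'] inU e by (simp add: o_def)
  \<comment> \<open>Along the circle d/dt acts as i z d/dz. Applying this twice to w gives -(z w' +
    z^2 w'').\<close>
  have G': "(G' has_vector_derivative - (A + B)) (at 0)"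
  proof -
    have 1: "((\<lambda>t. deriv w (e t)) has_vector_derivative \<i> * e 0 * deriv (deriv w) (e 0)) (at 0)"
      using field_vector_diff_chain_at [OF e' w''] inU e by (simp add: o_def)
    show ?thesis
      unfolding G'_def A_def B_def
      by (rule derivative_eq_intros e' 1 refl | simp add: e_def algebra_simps power2_eq_square)+
  qed
  have cnj_G: "((\<lambda>t. cnj (G t)) has_vector_derivative cnj (G' t)) (at t)" for t
    by (rule bounded_linear.has_vector_derivative [OF bounded_linear_cnj G])
  \<comment> \<open>This is |w|^2 on the circle, written as a product so that the product rule for
    vector derivatives applies.\<close>
  define f where "f = (\<lambda>t. Re (cnj (G t) * G t))"
  define f' where "f' = (\<lambda>t. 2 * Re (cnj (G t) * G' t))"
  have f: "(f has_real_derivative f' t) (at t)" for t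
  proof -
    have "(f has_vector_derivative Re (cnj (G t) * G' t + cnj (G' t) * G t)) (at t)"
      unfolding f_def
      by (rule bounded_linear.has_vector_derivative [OF bounded_linear_Re
            has_vector_derivative_mult [OF cnj_G G]])
    thus ?thesis
      by (simp add: f'_def has_real_derivative_iff_has_vector_derivative algebra_simps)
  qed
  have f': "(f' has_real_derivative 2 * (cmod A)\<^sup>2 - 2 * Re (cnj \<xi> * (A + B))) (at 0)"
  proof -
    have "((\<lambda>t. Re (cnj (G t) * G' t)) has_vector_derivative
            Re (cnj \<xi> * (- (A + B)) + cnj (G' 0) * G' 0)) (at 0)"
      using bounded_linear.has_vector_derivative [OF bounded_linear_Re
        has_vector_derivative_mult [OF cnj_G G']] by (simp add: G_def e_def \<xi>_def)
    moreover have "cnj (G' 0) * G' 0 = of_real ((cmod A)\<^sup>2)"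
      unfolding complex_norm_square by (simp add: G'_def e_def A_def algebra_simps)
    hence "Re (cnj \<xi> * (- (A + B)) + cnj (G' 0) * G' 0) = (cmod A)\<^sup>2 - Re (cnj \<xi> * (A + B))"
      by (simp only: plus_complex.sel Re_complex_of_real mult_minus_right uminus_complex.sel)
    ultimately have "((\<lambda>t. Re (cnj (G t) * G' t)) has_real_derivative
            (cmod A)\<^sup>2 - Re (cnj \<xi> * (A + B))) (at 0)"
      by (simp only: has_real_derivative_iff_has_vector_derivative)
    from DERIV_cmult [OF this, of 2] show ?thesis
      by (simp add: f'_def algebra_simps)
  qed
  have f_eq: "f t = (cmod (w (e t)))\<^sup>2" for t
    by (simp add: f_def G_def cmod_power2 flip: power2_eq_square)
  have on_circle: "cmod (w z) \<le> 1" if "cmod z \<le> cmod z0" for z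
  proof -
    have "z \<in> closure (ball 0 (cmod z0))"
      using that z0 by simp
    moreover have "continuous_on (closure (ball 0 (cmod z0))) w"
      using z0 holomorphic_on_imp_continuous_on [OF w] U(2) by (auto intro: continuous_on_subset)
    ultimately show ?thesis
      by (intro continuous_on_closure_norm_le [where f = w and s = "ball 0 (cmod z0)"])
        (simp_all add: le1 less_imp_le)
  qed
  have "f t \<le> f 0" for t
    using on_circle [of "e t"] e [of t] eq1 by (simp add: f_eq e_def power_le_one)
  note max = second_deriv_le_at_global_max [OF f f' this]
  have "G 0 = \<xi>" "G' 0 = \<i> * A"
    by (simp_all add: G_def G'_def e_def \<xi>_def A_def)
  hence im: "Re (cnj \<xi> * (\<i> * A)) = 0"
    using max(1) by (simp add: f'_def del: times_complex.sel)
  \<comment> \<open>The second derivative of |G|^2 at 0 is 2|G'|^2 + 2 Re(cnj G * G''), with |G'(0)|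
    = |A| and G''(0) = -(A + B).\<close>
  have D: "(cmod A)\<^sup>2 \<le> Re (cnj \<xi> * (A + B))"
    using max(2) by linarith
  define m where "m = Re (cnj \<xi> * A)"
  have "cnj \<xi> * A = of_real m"
    using im by (simp add: m_def complex_eq_iff)
  hence A: "A = of_real m * \<xi>"
    using xi(2) by (metis mult.commute mult.left_commute mult_1)
  have "m \<ge> 1"
  proof (rule ccontr)
    assume m: "\<not> m \<ge> 1"
    \<comment> \<open>By the Schwarz lemma for z \<mapsto> w(z z0), \<open>h\<close> is nonnegative
      on (0, 1), and it vanishes at 1. If m < 1, its derivative 1 - m > 0 at 1 would make it
      negative just to the left of 1.\<close>
    define h where "h = (\<lambda>t. t - Re (cnj \<xi> * w (of_real t * z0)))"
    have "((\<lambda>t. cnj \<xi> * w (of_real t * z0)) has_vector_derivative cnj \<xi> * A) (at 1)"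
    proof -
      have "((\<lambda>t. of_real t * z0) has_vector_derivative z0) (at 1)"
        by (auto intro!: derivative_eq_intros has_vector_derivative_real_field)
      from field_vector_diff_chain_at [OF this, of w "deriv w z0"]
      have "((\<lambda>t. w (of_real t * z0)) has_vector_derivative A) (at 1)"
        using w' inU by (simp add: o_def A_def)
      thus ?thesis
        by (rule bounded_linear.has_vector_derivative [OF bounded_linear_mult_right])
    qed
    from bounded_linear.has_vector_derivative [OF bounded_linear_Re this]
    have "(h has_real_derivative 1 - m) (at 1)"
      unfolding h_def m_def has_real_derivative_iff_has_vector_derivative [symmetric]
      by (rule DERIV_diff [OF DERIV_ident])
    then obtain d where d: "d > 0" "\<And>x. 0 < x \<Longrightarrow> x < d \<Longrightarrow> h (1 - x) < h 1"
      using DERIV_pos_inc_left [of h "1 - m" 1] m by auto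
    define x where "x = min (d / 2) (1 / 2)"
    have x: "0 < x" "x < d" "x < 1"
      using d(1) by (auto simp: x_def)
    have "cmod (w (of_real (1 - x) * z0)) \<le> cmod (of_real (1 - x))"
    proof (rule Schwarz_Lemma(1) [where f = "\<lambda>z. w (z * z0)" and \<xi> = "of_real (1 - x)"])
      show "(\<lambda>z. w (z * z0)) holomorphic_on ball 0 1"
      proof (rule holomorphic_on_compose_gen [unfolded o_def, OF _ w])
        show "(\<lambda>z. z * z0) ` ball 0 1 \<subseteq> U"
          by (auto simp: norm_mult intro!: inU mult_left_le_one_le)
      qed (intro holomorphic_intros)
      show "cmod (w (z * z0)) < 1" if "cmod z < 1" for z
        using that z0 by (intro le1) (simp add: norm_mult)
      show "cmod (of_real (1 - x)) < 1"
        using x unfolding norm_of_real by simp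
    qed (simp add: w0)
    moreover have "Re (cnj \<xi> * w (of_real (1 - x) * z0)) \<le> cmod (w (of_real (1 - x) * z0))"
      using complex_Re_le_cmod [of "cnj \<xi> * w (of_real (1 - x) * z0)"] xi(1) by (simp add: norm_mult)
    moreover have "cmod (of_real (1 - x)) = 1 - x"
      using x unfolding norm_of_real by simp
    ultimately have "h (1 - x) \<ge> 0"
      unfolding h_def by linarith
    moreover have "h 1 = 0"
      using xi(2) by (simp add: h_def \<xi>_def [symmetric] del: times_complex.sel)
    ultimately show False
      using d(2) [OF x(1,2)] by simp
  qed
  have "z0 * deriv (deriv w) z0 / deriv w z0 = B / A"
    using z0 by (simp add: A_def B_def power2_eq_square)
  also have "\<dots> = cnj \<xi> * B / of_real m"
  proof -
    have "\<xi> \<noteq> 0"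
      using xi(1) by auto
    hence "cnj \<xi> = 1 / \<xi>"
      using xi(2) by (simp add: eq_divide_eq)
    thus ?thesis
      by (simp add: A)
  qed
  finally have ratio: "Re (z0 * deriv (deriv w) z0 / deriv w z0) = Re (cnj \<xi> * B) / m"
    by simp
  \<comment> \<open>This is \<open>D\<close> with |A| = m and cnj \<xi> * A = m; dividing by m > 0
    then gives the claim.\<close>
  have "m\<^sup>2 \<le> m + Re (cnj \<xi> * B)"
  proof -
    have "cmod A = m"
      using xi(1) \<open>m \<ge> 1\<close> by (simp add: A norm_mult)
    thus ?thesis
      using D by (simp only: distrib_left plus_complex.sel m_def)
  qed
  hence "m * m \<le> m * (1 + Re (cnj \<xi> * B) / m)"
    using \<open>m \<ge> 1\<close> by (simp add: distrib_left power2_eq_square del: times_complex.sel)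
  hence "m \<le> 1 + Re (cnj \<xi> * B) / m"
    using \<open>m \<ge> 1\<close> by (subst (asm) mult_le_cancel_left_pos) auto
  hence "m \<le> Re (1 + z0 * deriv (deriv w) z0 / deriv w z0)"
    unfolding plus_complex.sel ratio by simp
  with \<open>m \<ge> 1\<close> A show ?thesis
    using that by (simp add: A_def \<xi>_def)
qed

section \<open>The Miller--Mocanu lemma\<close>

text \<open>With p = q \<circ> w, the chain rule turns Jack's lemma for w into the claims about p.
  Univalence on a disc of radius \<open>R > 1\<close> keeps the inverse of q holomorphic near the
  image of the unit circle, where w must be differentiated twice.\<close>

lemma Miller_Mocanu:
  fixes p q :: "complex \<Rightarrow> complex"
  assumes q: "q holomorphic_on ball 0 R" "inj_on q (ball 0 R)" "R > 1"
    and p: "p holomorphic_on \<D>" "p 0 = q 0"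
    and leaves: "\<not> p ` \<D> \<subseteq> q ` \<D>"
  obtains z0 \<xi> and m :: real where "z0 \<in> \<D>" "cmod \<xi> = 1" "m \<ge> 1"
    "p z0 = q \<xi>" "z0 * deriv p z0 = of_real m * \<xi> * deriv q \<xi>"
    "Re (1 + z0\<^sup>2 * deriv (deriv p) z0 / (z0 * deriv p z0)) \<ge>
      m * Re (1 + \<xi> * deriv (deriv q) \<xi> / deriv q \<xi>)"
proof -
  define V where "V = q ` ball 0 R"
  obtain g where g: "g holomorphic_on V"
    and q'_nz: "\<And>z. z \<in> ball 0 R \<Longrightarrow> deriv q z * deriv g (q z) = 1"
    and gq: "\<And>z. z \<in> ball 0 R \<Longrightarrow> g (q z) = z"
    using holomorphic_has_inverse [OF q(1) open_ball q(2)] unfolding V_def by metis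
  have openV: "open V"
    unfolding V_def by (rule open_mapping_thm3 [OF q(1) open_ball q(2)])
  have discs: "\<D> \<subseteq> ball 0 R" "cball 0 1 \<subseteq> ball (0::complex) R"
    using q(3) by auto
  have openqD: "open (q ` \<D>)"
    using open_mapping_thm3 [OF holomorphic_on_subset [OF q(1) discs(1)] open_ball
        inj_on_subset [OF q(2) discs(1)]] .
  have pcont: "continuous_on \<D> p"
    using p(1) by (rule holomorphic_on_imp_continuous_on)

  obtain z1 where z1: "z1 \<in> \<D>" "p z1 \<notin> q ` \<D>"
    using leaves by (meson image_subsetI)
  \<comment> \<open>The points of a closed disc where p avoids the open set q(\<D>) form a compact
    set, so one of least modulus exists.\<close>
  define K where "K = cball 0 (cmod z1) \<inter> p -` (- (q ` \<D>))"
  have "closed K"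
    unfolding K_def using z1(1) openqD
    by (intro continuous_closed_preimage continuous_on_subset [OF pcont]) auto
  hence "compact K"
    by (simp add: compact_eq_bounded_closed K_def bounded_subset [OF bounded_cball] bounded_Int)
  moreover have "z1 \<in> K"
    using z1 by (auto simp: K_def)
  ultimately obtain z0 where z0: "z0 \<in> K" "\<And>z. z \<in> K \<Longrightarrow> cmod z0 \<le> cmod z"
    using continuous_attains_inf [of K cmod] continuous_on_norm_id by blast
  have z0D: "z0 \<in> \<D>" and z0out: "p z0 \<notin> q ` \<D>" and z0z1: "cmod z0 \<le> cmod z1"
    using z0(1) z1(1) by (auto simp: K_def)
  have inside: "p z \<in> q ` \<D>" if "cmod z < cmod z0" for z
    using z0(2) [of z] that z0z1 by (force simp: K_def)
  have "z0 \<noteq> 0"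
    using z0out p(2) by auto

  \<comment> \<open>The image of the closed unit disc under q is compact, hence closed, so the
    inclusion passes from the open disc of radius |z0| to its closure.\<close>
  have on_cball: "p z \<in> q ` cball 0 1" if "cmod z \<le> cmod z0" for z
  proof -
    have cl: "closure (ball (0::complex) (cmod z0)) = cball 0 (cmod z0)"
      using \<open>z0 \<noteq> 0\<close> by simp
    have "p ` closure (ball 0 (cmod z0)) \<subseteq> q ` cball 0 1"
    proof (rule image_closure_subset)
      show "continuous_on (closure (ball 0 (cmod z0))) p"
        unfolding cl using z0D by (intro continuous_on_subset [OF pcont]) auto
      have "continuous_on (cball 0 1) q"
        using q(1) discs(2)
        by (meson continuous_on_subset holomorphic_on_imp_continuous_on)
      thus "closed (q ` cball 0 1)"
        by (intro compact_imp_closed compact_continuous_image) auto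
      show "p ` ball 0 (cmod z0) \<subseteq> q ` cball 0 1"
        using inside by fastforce
    qed
    thus ?thesis
      using that unfolding cl by auto
  qed
  define U where "U = \<D> \<inter> p -` V"
  have openU: "open U"
    unfolding U_def by (rule continuous_open_preimage [OF pcont open_ball openV])
  have subU: "cball 0 (cmod z0) \<subseteq> U"
    using z0D on_cball discs(2) by (fastforce simp: U_def V_def)
  define w where "w = (\<lambda>z. g (p z))"
  have w: "w holomorphic_on U"
    unfolding w_def
    by (intro holomorphic_on_compose_gen [unfolded o_def, OF _ g] holomorphic_on_subset [OF p(1)])
      (auto simp: U_def)
  have qw: "q (w z) = p z" "w z \<in> ball 0 R" if "z \<in> U" for z
    using that gq by (auto simp: U_def V_def w_def)
  have w_lt1: "cmod (w z) < 1" if "cmod z < cmod z0" for z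
    using inside [OF that] gq discs(1) by (auto simp: w_def)
  have z0U: "z0 \<in> U"
    using subU by auto
  define \<xi> where "\<xi> = w z0"
  have "cmod \<xi> \<le> 1"
    using on_cball [of z0] gq discs(2) by (auto simp: \<xi>_def w_def)
  \<comment> \<open>Otherwise p(z0) = q(\<xi>) would lie in q(\<D>).\<close>
  moreover have "\<not> cmod \<xi> < 1"
    using z0out qw(1) [OF z0U] by (force simp: \<xi>_def)
  ultimately have xi1: "cmod \<xi> = 1"
    by simp
  have w0: "w 0 = 0"
    using gq [of 0] q(3) p(2) by (simp add: w_def)
  obtain m :: real where m: "m \<ge> 1" "z0 * deriv w z0 = of_real m * \<xi>"
      "m \<le> Re (1 + z0 * deriv (deriv w) z0 / deriv w z0)"
    using Jack_lemma [OF w openU subU w0 \<open>z0 \<noteq> 0\<close> w_lt1] xi1 unfolding \<xi>_def by blast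

  have xiR: "\<xi> \<in> ball 0 R"
    using xi1 q(3) by simp
  have dw: "(w has_field_derivative deriv w z) (at z)" if "z \<in> U" for z
    using holomorphic_derivI [OF w openU that] .
  have ddw: "(deriv w has_field_derivative deriv (deriv w) z) (at z)" if "z \<in> U" for z
    using holomorphic_derivI [OF holomorphic_deriv [OF w openU] openU that] .
  have dq: "(q has_field_derivative deriv q z) (at z)" if "z \<in> ball 0 R" for z
    using holomorphic_derivI [OF q(1) open_ball that] .
  have ddq: "(deriv q has_field_derivative deriv (deriv q) z) (at z)" if "z \<in> ball 0 R" for z
    using holomorphic_derivI [OF holomorphic_deriv [OF q(1) open_ball] open_ball that] .
  have dp: "deriv p z = deriv q (w z) * deriv w z" if "z \<in> U" for z
  proof (rule DERIV_imp_deriv)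
    have "((\<lambda>z. q (w z)) has_field_derivative deriv q (w z) * deriv w z) (at z)"
      by (rule DERIV_chain2 [OF dq dw]) (use that qw in auto)
    thus "(p has_field_derivative deriv q (w z) * deriv w z) (at z)"
      by (rule has_field_derivative_transform_within_open [OF _ openU that]) (rule qw(1))
  qed
  have ddp: "deriv (deriv p) z0 =
      deriv (deriv q) \<xi> * (deriv w z0)\<^sup>2 + deriv q \<xi> * deriv (deriv w) z0"
  proof (rule DERIV_imp_deriv)
    have 1: "((\<lambda>z. deriv q (w z)) has_field_derivative deriv (deriv q) \<xi> * deriv w z0) (at z0)"
      unfolding \<xi>_def by (rule DERIV_chain2 [OF ddq dw]) (use z0U qw in auto)
    have "((\<lambda>z. deriv q (w z) * deriv w z) has_field_derivative
        deriv (deriv q) \<xi> * (deriv w z0)\<^sup>2 + deriv q \<xi> * deriv (deriv w) z0) (at z0)"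
      by (rule derivative_eq_intros 1 ddw [OF z0U] refl
          | simp add: \<xi>_def power2_eq_square algebra_simps)+
    thus "(deriv p has_field_derivative
        deriv (deriv q) \<xi> * (deriv w z0)\<^sup>2 + deriv q \<xi> * deriv (deriv w) z0) (at z0)"
      by (rule has_field_derivative_transform_within_open [OF _ openU z0U]) (simp add: dp)
  qed
  have q'xi: "deriv q \<xi> \<noteq> 0"
    using q'_nz [OF xiR] by auto
  have w'z0: "deriv w z0 \<noteq> 0"
    using m(1,2) xi1 by auto
  \<comment> \<open>This is z0 times the logarithmic derivative of p' = (q' \<circ> w) w' at z0;
    Jack's lemma replaces z0 w'(z0) by m \<xi> in the first summand and bounds the second.\<close>
  have "z0\<^sup>2 * deriv (deriv p) z0 / (z0 * deriv p z0)
      = (z0 * deriv w z0) * deriv (deriv q) \<xi> / deriv q \<xi> + z0 * deriv (deriv w) z0 / deriv w z0"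
    using q'xi w'z0 \<open>z0 \<noteq> 0\<close> dp [OF z0U]
    by (simp add: ddp \<xi>_def [symmetric] field_simps power2_eq_square)
  also have "\<dots> = of_real m * (\<xi> * deriv (deriv q) \<xi> / deriv q \<xi>)
      + z0 * deriv (deriv w) z0 / deriv w z0"
    by (simp add: m(2))
  finally have "Re (1 + z0\<^sup>2 * deriv (deriv p) z0 / (z0 * deriv p z0)) =
      m * Re (\<xi> * deriv (deriv q) \<xi> / deriv q \<xi>)
      + Re (1 + z0 * deriv (deriv w) z0 / deriv w z0)"
    by (simp only: plus_complex.sel Re_complex_of_real Im_complex_of_real times_complex.sel
        mult_zero_left diff_zero add.left_commute)
  with m(3) have "Re (1 + z0\<^sup>2 * deriv (deriv p) z0 / (z0 * deriv p z0)) \<ge>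
      m * Re (1 + \<xi> * deriv (deriv q) \<xi> / deriv q \<xi>)"
    by (simp add: distrib_left)
  moreover have "z0 * deriv p z0 = of_real m * \<xi> * deriv q \<xi>"
    using dp [OF z0U] m(2) by (simp add: \<xi>_def [symmetric] mult.assoc mult.left_commute mult.commute)
  moreover have "p z0 = q \<xi>"
    using qw(1) [OF z0U] by (simp add: \<xi>_def)
  ultimately show ?thesis
    using that z0D xi1 m(1) by blast
qed

text \<open>The required self-map of the disc is the holomorphic inverse of q composed with
  p.\<close>

lemma subordinate_univalentI:
  assumes p: "p holomorphic_on \<D>" and q: "q holomorphic_on \<D>" "inj_on q \<D>"
    and "p 0 = q 0" and sub: "p ` \<D> \<subseteq> q ` \<D>"
  shows "p \<prec>\<^sub>\<D> q"
proof -
  obtain g where g: "g holomorphic_on q ` \<D>" "\<And>z. z \<in> \<D> \<Longrightarrow> g (q z) = z"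
    using holomorphic_has_inverse [OF q(1) open_ball q(2)] by metis
  have "(\<lambda>z. g (p z)) holomorphic_on \<D>"
    using holomorphic_on_compose_gen [OF p g(1)] sub by (auto simp: o_def)
  moreover have "g (p z) \<in> \<D> \<and> q (g (p z)) = p z" if "z \<in> \<D>" for z
    using sub g(2) that by force
  moreover have "g (p 0) = 0"
    using g(2) [of 0] \<open>p 0 = q 0\<close> by simp
  ultimately show ?thesis
    unfolding subordinate_def using p q(1) by (fastforce intro!: exI [of _ "\<lambda>z. g (p z)"])
qed

section \<open>The function \<open>cosh_sqrt\<close>\<close>

text \<open>The everywhere convergent power series is used, since \<open>csqrt\<close> is
  discontinuous across its branch cut.\<close>

lemma cosh_sqrt_holomorphic: "cosh_sqrt holomorphic_on S"
proof -
  have "cosh_sqrt holomorphic_on ball 0 r" for r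
    using cosh_sqrt_sums
    by (intro power_series_holomorphic [of 0 r "\<lambda>n. 1 / fact (2 * n)"]) (simp add: cosh_sqrt_eq)
  hence "cosh_sqrt field_differentiable at z" for z
    by (rule holomorphic_on_imp_differentiable_at [of _ "ball 0 (cmod z + 1)"]) auto
  thus ?thesis
    by (simp add: holomorphic_on_def field_differentiable_at_within)
qed

text \<open>If cosh u = cosh v, then u - v or u + v is a multiple of 2 \<pi> i. For |u|, |v| < 3 its
  modulus is below 6 < 2 \<pi>, so u = v or u = -v, and the squares agree. The radius 9 = 3^2 is a
  convenient value between 1 and \<pi>^2.\<close>

lemma cosh_sqrt_inj: "inj_on cosh_sqrt (ball 0 9)"
proof (rule inj_onI)
  fix x y :: complex assume x: "x \<in> ball 0 9" and y: "y \<in> ball 0 9"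
    and eq: "cosh_sqrt x = cosh_sqrt y"
  define u v where "u = csqrt x" and "v = csqrt y"
  have uv: "u\<^sup>2 = x" "v\<^sup>2 = y" "cosh u = cosh v"
    using eq by (auto simp: u_def v_def cosh_sqrt_eq)
  have "(cmod u)\<^sup>2 < 3\<^sup>2" "(cmod v)\<^sup>2 < 3\<^sup>2"
    using x y by (simp_all flip: uv(1,2) norm_power)
  hence lt: "cmod u < 3" "cmod v < 3"
    using power_less_imp_less_base [of "cmod _" 2 3] by auto
  have "cos (\<i> * u) = cos (\<i> * v)"
    using uv(3) by (simp add: cosh_conv_cos)
  then obtain n :: real where n: "n \<in> \<int>"
      "\<i> * u = \<i> * v + of_real (2 * n * pi) \<or> \<i> * u = - (\<i> * v) + of_real (2 * n * pi)"
    by (auto simp: complex_cos_eq)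
  hence "\<i> * (u - v) = of_real (2 * n * pi) \<or> \<i> * (u + v) = of_real (2 * n * pi)"
    by (auto simp: algebra_simps)
  hence "cmod (u - v) = \<bar>2 * n * pi\<bar> \<or> cmod (u + v) = \<bar>2 * n * pi\<bar>"
    by (metis norm_ii norm_mult mult_1 norm_of_real real_norm_def)
  hence "\<bar>2 * n * pi\<bar> < 6"
    using norm_triangle_ineq4 [of u v] norm_triangle_ineq [of u v] lt by linarith
  hence "\<bar>n\<bar> * pi < 3"
    by (simp add: abs_mult mult.commute)
  moreover have "\<bar>n\<bar> * 3 \<le> \<bar>n\<bar> * pi"
    using pi_gt3 by (intro mult_left_mono) auto
  ultimately have "\<bar>n\<bar> < 1"
    by linarith
  hence "n = 0"
    using n(1) Ints_nonzero_abs_less1 by blast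
  hence "u = v \<or> u = - v"
    using n(2) by (metis add_0_right complex_i_not_zero mult_cancel_left mult_minus_right
        mult_zero_left mult_zero_right of_real_0)
  with uv show "x = y"
    by auto
qed

text \<open>Differentiate cosh_sqrt(u^2) = cosh u; the substitution z = u^2 avoids differentiating
  \<open>csqrt\<close>. The next lemma differentiates once more.\<close>

lemma deriv_cosh_sqrt: "2 * u * deriv cosh_sqrt (u\<^sup>2) = sinh u"
proof (rule DERIV_unique)
  have 1: "(cosh_sqrt has_field_derivative deriv cosh_sqrt z) (at z)" for z
    using holomorphic_derivI [OF cosh_sqrt_holomorphic open_UNIV] by simp
  show "((\<lambda>u. cosh_sqrt (u\<^sup>2)) has_field_derivative 2 * u * deriv cosh_sqrt (u\<^sup>2)) (at u)"
    by (rule DERIV_chain2 [OF 1, THEN DERIV_cong]) (auto intro!: derivative_eq_intros)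
  show "((\<lambda>u. cosh_sqrt (u\<^sup>2)) has_field_derivative sinh u) (at u)"
    unfolding cosh_sqrt_power2 by (auto intro!: derivative_eq_intros)
qed

lemma deriv2_cosh_sqrt:
  "2 * deriv cosh_sqrt (u\<^sup>2) + 4 * u\<^sup>2 * deriv (deriv cosh_sqrt) (u\<^sup>2) = cosh u"
proof (rule DERIV_unique)
  have 1: "(deriv cosh_sqrt has_field_derivative deriv (deriv cosh_sqrt) z) (at z)" for z
    using holomorphic_derivI [OF holomorphic_deriv [OF cosh_sqrt_holomorphic open_UNIV]] by simp
  have 2: "((\<lambda>u. deriv cosh_sqrt (u\<^sup>2)) has_field_derivative
      deriv (deriv cosh_sqrt) (u\<^sup>2) * (2 * u)) (at u)"
    by (rule DERIV_chain2 [OF 1]) (auto intro!: derivative_eq_intros)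
  show "((\<lambda>u. 2 * u * deriv cosh_sqrt (u\<^sup>2)) has_field_derivative
      2 * deriv cosh_sqrt (u\<^sup>2) + 4 * u\<^sup>2 * deriv (deriv cosh_sqrt) (u\<^sup>2)) (at u)"
    by (rule derivative_eq_intros 2 refl | simp add: power2_eq_square algebra_simps)+
  show "((\<lambda>u. 2 * u * deriv cosh_sqrt (u\<^sup>2)) has_field_derivative cosh u) (at u)"
    unfolding deriv_cosh_sqrt by (auto intro!: derivative_eq_intros)
qed

section \<open>The minimum of \<open>Re (v * cosh v / sinh v)\<close> on the unit circle\<close>

text \<open>Both bounds follow from \<pi>/4 < 1 < \<pi>/3.\<close>

lemma cot_one_bounds: "1 / 2 \<le> cot (1::real)" "cot (1::real) \<le> 1"
proof -
  have s: "sin (1::real) > 0"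
    using pi_gt3 by (intro sin_gt_zero) auto
  have "cos (pi / 3) \<le> cos (1::real)"
    using pi_gt3 by (intro cos_monotone_0_pi_le) auto
  moreover have "cos (pi / 3) = 1 / 2"
    by (rule cos_60)
  ultimately have "sin (1::real) \<le> 2 * cos 1"
    using sin_le_one [of 1] by linarith
  thus "1 / 2 \<le> cot (1::real)"
    using s by (simp add: cot_def field_simps)
  have "cos (1::real) \<le> cos (pi / 4)"
    using pi_less_4 pi_gt3 by (intro cos_monotone_0_pi_le) auto
  moreover have "sin (pi / 4) \<le> sin (1::real)"
    using pi_less_4 pi_gt3 by (intro sin_monotone_2pi_le) auto
  ultimately have "cos (1::real) \<le> sin 1"
    by (simp add: cos_45 sin_45)
  thus "cot (1::real) \<le> 1"
    using s by (simp add: cot_def field_simps)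
qed

text \<open>The difference vanishes at 0 and has derivative x sin x. Together with its hyperbolic
  analogue below, this compares the two brackets of the derivative in
  \<open>cot_one_le_aux\<close>.\<close>

lemma mult_cos_le_sin:
  fixes t :: real
  assumes "0 \<le> t" "t \<le> pi"
  shows "t * cos t \<le> sin t"
proof -
  have "sin 0 - 0 * cos 0 \<le> sin t - t * cos t"
  proof (rule DERIV_nonneg_imp_nondecreasing [OF assms(1)])
    fix x assume "0 \<le> x" "x \<le> t"
    thus "\<exists>y. ((\<lambda>t. sin t - t * cos t) has_real_derivative y) (at x) \<and> 0 \<le> y"
      using assms sin_ge_zero [of x]
      by (intro exI [of _ "x * sin x"]) (auto intro!: derivative_eq_intros)
  qed
  thus ?thesis
    by simp
qed

lemma sinh_le_mult_cosh:
  fixes t :: real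
  assumes "0 \<le> t"
  shows "sinh t \<le> t * cosh t"
proof -
  have "0 * cosh 0 - sinh 0 \<le> t * cosh t - sinh t"
  proof (rule DERIV_nonneg_imp_nondecreasing [OF assms(1)])
    fix x assume "0 \<le> x" "x \<le> t"
    thus "\<exists>y. ((\<lambda>t. t * cosh t - sinh t) has_real_derivative y) (at x) \<and> 0 \<le> y"
      by (intro exI [of _ "x * sinh x"]) (auto intro!: derivative_eq_intros)
  qed
  thus ?thesis
    by simp
qed

text \<open>
  Along the circle, \<open>d / d\<theta>\<close> of the right side minus the left side is
  \<open>2xy (cosh 2x - cos 2y) - (2 cot 1 - 1) (y sinh 2x - x sin 2y)\<close>, which is nonnegative because
  \<open>0 \<le> 2 cot 1 - 1 \<le> 1\<close>; both sides agree at \<open>x = 0\<close>, \<open>y = 1\<close>.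
\<close>
lemma cot_one_le_aux:
  fixes \<theta> :: real
  assumes "0 \<le> \<theta>" "\<theta> \<le> pi / 2"
  defines "x \<equiv> sin \<theta>" and "y \<equiv> cos \<theta>"
  shows "cot 1 * (cosh (2 * x) - cos (2 * y)) \<le> x * sinh (2 * x) + y * sin (2 * y)"
proof -
  define c :: real where "c = cot 1"
  define G where "G = (\<lambda>\<theta>. sin \<theta> * sinh (2 * sin \<theta>) + cos \<theta> * sin (2 * cos \<theta>)
     - c * (cosh (2 * sin \<theta>) - cos (2 * cos \<theta>)))"
  have "G 0 \<le> G \<theta>"
  proof (rule DERIV_nonneg_imp_nondecreasing [OF assms(1)])
    fix a assume a: "0 \<le> a" "a \<le> \<theta>"
    define x y where "x = sin a" and "y = cos a"
    have x: "0 \<le> x" and y: "0 \<le> y"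
      using a assms(2) by (auto simp: x_def y_def intro!: sin_ge_zero cos_ge_zero)
    have "y \<le> 1"
      by (simp add: y_def)
    define D where
      "D = 2 * x * y * (cosh (2 * x) - cos (2 * y)) - (2 * c - 1) * (y * sinh (2 * x) - x * sin (2 * y))"
    have "(G has_real_derivative D) (at a)"
      unfolding G_def D_def x_def y_def
      by (auto intro!: derivative_eq_intros simp: algebra_simps)
    moreover have "D \<ge> 0"
    proof -
      have "y * sinh (2 * x) \<le> y * (2 * x * cosh (2 * x))"
        using x y sinh_le_mult_cosh [of "2 * x"] by (intro mult_left_mono) auto
      moreover have "x * (2 * y * cos (2 * y)) \<le> x * sin (2 * y)"
        using x y \<open>y \<le> 1\<close> pi_gt3 mult_cos_le_sin [of "2 * y"] by (intro mult_left_mono) auto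
      ultimately have le: "y * sinh (2 * x) - x * sin (2 * y) \<le> 2 * x * y * (cosh (2 * x) - cos (2 * y))"
        by (simp add: algebra_simps)
      have "cos (2 * y) \<le> cosh (2 * x)"
        using cos_le_one [of "2 * y"] cosh_real_ge_1 [of "2 * x"] by linarith
      hence nn: "0 \<le> 2 * x * y * (cosh (2 * x) - cos (2 * y))"
        using x y by simp
      have c: "0 \<le> 2 * c - 1" "2 * c - 1 \<le> 1"
        using cot_one_bounds by (auto simp: c_def)
      have "(2 * c - 1) * (y * sinh (2 * x) - x * sin (2 * y))
          \<le> (2 * c - 1) * (2 * x * y * (cosh (2 * x) - cos (2 * y)))"
        using le c(1) by (rule mult_left_mono)
      also have "\<dots> \<le> 1 * (2 * x * y * (cosh (2 * x) - cos (2 * y)))"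
        using c(2) nn by (rule mult_right_mono)
      finally show ?thesis
        by (simp add: D_def)
    qed
    ultimately show "\<exists>D. (G has_real_derivative D) (at a) \<and> 0 \<le> D"
      by blast
  qed
  \<comment> \<open>At x = 0, y = 1 the inequality is the equality cot 1 (1 - cos 2) = sin 2, which
    is what singles out the constant cot 1.\<close>
  moreover have "G 0 = 0"
  proof -
    have "sin (1::real) > 0"
      using pi_gt3 by (intro sin_gt_zero) auto
    hence "cot 1 * (2 * (sin (1::real))\<^sup>2) = 2 * sin 1 * cos 1"
      by (simp add: cot_def power2_eq_square)
    hence "cot 1 * (1 - cos (2::real)) = sin 2"
      using sin_double [of "1::real"] cos_double_sin [of "1::real"] by simp
    thus ?thesis
      by (simp add: G_def c_def)
  qed
  ultimately show ?thesis
    by (simp add: G_def c_def x_def y_def)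
qed

text \<open>Both sides are even in x and in y, so the first quadrant suffices.\<close>

lemma cot_one_le:
  fixes x y :: real
  assumes "x\<^sup>2 + y\<^sup>2 = 1"
  shows "cot 1 * (cosh (2 * x) - cos (2 * y)) \<le> x * sinh (2 * x) + y * sin (2 * y)"
proof -
  have "\<bar>y\<bar>\<^sup>2 + \<bar>x\<bar>\<^sup>2 = 1"
    using assms by simp
  then obtain \<theta> where \<theta>: "0 \<le> \<theta>" "\<theta> \<le> pi / 2" "\<bar>y\<bar> = cos \<theta>" "\<bar>x\<bar> = sin \<theta>"
    using sincos_total_pi_half [of "\<bar>y\<bar>" "\<bar>x\<bar>"] by auto
  have "cot 1 * (cosh (2 * \<bar>x\<bar>) - cos (2 * \<bar>y\<bar>)) \<le> \<bar>x\<bar> * sinh (2 * \<bar>x\<bar>) + \<bar>y\<bar> * sin (2 * \<bar>y\<bar>)"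
    using cot_one_le_aux [OF \<theta>(1,2)] by (simp add: \<theta>(3,4))
  thus ?thesis
    by (simp add: abs_if split: if_splits)
qed

text \<open>For v = x + iy, multiplying numerator and denominator by the conjugate of sinh v gives
  the real part (x sinh 2x + y sin 2y) / (cosh 2x - cos 2y), to which \<open>cot_one_le\<close>
  applies.\<close>

lemma Re_mult_coth_ge:
  fixes v :: complex
  assumes "cmod v = 1"
  shows "sinh v \<noteq> 0" "cot 1 \<le> Re (v * cosh v / sinh v)"
proof -
  define x y where "x = Re v" and "y = Im v"
  have v: "v = Complex x y"
    by (simp add: x_def y_def)
  have xy: "x\<^sup>2 + y\<^sup>2 = 1"
    using assms by (simp add: x_def y_def cmod_def)
  define d where "d = cosh (2 * x) - cos (2 * y)"
  have "v = of_real x + \<i> * of_real y"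
    by (simp add: x_def y_def complex_eq)
  hence ch: "cosh v = Complex (cosh x * cos y) (sinh x * sin y)"
    and sh: "sinh v = Complex (sinh x * cos y) (cosh x * sin y)"
    by (simp_all add: cosh_field_def sinh_field_def complex_eq_iff Re_exp Im_exp field_simps)
  have hyp: "(cosh x)\<^sup>2 = 1 + (sinh x)\<^sup>2" and tri: "(cos y)\<^sup>2 = 1 - (sin y)\<^sup>2"
    by (simp_all add: cosh_square_eq cos_squared_eq)
  have d: "d = 2 * ((sinh x)\<^sup>2 + (sin y)\<^sup>2)"
    by (simp add: d_def cosh_double cos_double hyp tri)
  have norm2: "2 * (cmod (sinh v))\<^sup>2 = d"
    by (simp add: sh d cmod_power2 power_mult_distrib hyp tri algebra_simps)
  have "d > 0"
  proof -
    \<comment> \<open>On the unit circle x = 0 forces y = 1 or y = -1, where sin y does not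
      vanish.\<close>
    have "sinh x \<noteq> 0 \<or> sin y \<noteq> 0"
    proof (cases "x = 0")
      case True
      hence "y = 1 \<or> y = - 1"
        using xy by (simp add: power2_eq_1_iff)
      moreover have "sin (1::real) > 0"
        using pi_gt3 by (intro sin_gt_zero) auto
      ultimately show ?thesis
        by auto
    qed simp
    thus ?thesis
      by (auto simp: d add_pos_nonneg add_nonneg_pos)
  qed
  thus "sinh v \<noteq> 0"
    using norm2 by auto
  have "v * cosh v / sinh v = v * cosh v * cnj (sinh v) / of_real ((cmod (sinh v))\<^sup>2)"
    by (subst complex_div_cnj) simp
  hence "Re (v * cosh v / sinh v) = Re (v * (cosh v * cnj (sinh v))) / (d / 2)"
    using norm2 by (metis Re_divide_of_real mult.assoc nonzero_mult_div_cancel_left zero_neq_numeral)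
  also have "cosh v * cnj (sinh v) = Complex (sinh x * cosh x) (- (sin y * cos y))"
  proof (rule complex_eqI)
    have "Re (cosh v * cnj (sinh v)) = sinh x * cosh x * ((cos y)\<^sup>2 + (sin y)\<^sup>2)"
      by (simp add: ch sh power2_eq_square algebra_simps
          del: sin_cos_squared_add sin_cos_squared_add2 sin_cos_squared_add3)
    thus "Re (cosh v * cnj (sinh v)) = Re (Complex (sinh x * cosh x) (- (sin y * cos y)))"
      by simp
    have "Im (cosh v * cnj (sinh v)) = - (sin y * cos y) * ((cosh x)\<^sup>2 - (sinh x)\<^sup>2)"
      by (simp add: ch sh power2_eq_square algebra_simps)
    thus "Im (cosh v * cnj (sinh v)) = Im (Complex (sinh x * cosh x) (- (sin y * cos y)))"
      by (simp add: hyp)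
  qed
  also have "Re (v * \<dots>) = (x * sinh (2 * x) + y * sin (2 * y)) / 2"
    unfolding sinh_double sin_double by (simp add: v algebra_simps)
  also have "\<dots> / (d / 2) = (x * sinh (2 * x) + y * sin (2 * y)) / d"
    using \<open>d > 0\<close> by (simp add: field_simps)
  finally have "Re (v * cosh v / sinh v) = (x * sinh (2 * x) + y * sin (2 * y)) / d" .
  thus "cot 1 \<le> Re (v * cosh v / sinh v)"
    using cot_one_le [OF xy] \<open>d > 0\<close> by (simp add: le_divide_eq flip: d_def)
qed

section \<open>Admissible functions\<close>

text \<open>For v^2 = \<xi>, dividing the second-derivative identity by the first gives 1 + \<xi>
  q''/q' = 1/2 + (v coth v)/2, so the bound on v coth v yields (1 + cot 1)/2.\<close>

lemma cosh_sqrt_convexity: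
  assumes "cmod \<xi> = 1"
  shows "\<xi> * deriv cosh_sqrt \<xi> = csqrt \<xi> * sinh (csqrt \<xi>) / 2"
    and "(1 + cot 1) / 2 \<le> Re (1 + \<xi> * deriv (deriv cosh_sqrt) \<xi> / deriv cosh_sqrt \<xi>)"
proof -
  define v where "v = csqrt \<xi>"
  define q1 where "q1 = deriv cosh_sqrt \<xi>"
  define q2 where "q2 = deriv (deriv cosh_sqrt) \<xi>"
  have v2: "v\<^sup>2 = \<xi>"
    by (simp add: v_def)
  have v1: "cmod v = 1"
    using assms by (simp add: v_def)
  hence "v \<noteq> 0"
    by auto
  have q1: "2 * v * q1 = sinh v" and q2: "2 * q1 + 4 * \<xi> * q2 = cosh v"
    using deriv_cosh_sqrt [of v] deriv2_cosh_sqrt [of v] by (auto simp: v2 q1_def q2_def)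
  show "\<xi> * deriv cosh_sqrt \<xi> = csqrt \<xi> * sinh (csqrt \<xi>) / 2"
    unfolding v_def [symmetric] q1_def [symmetric] q1 [symmetric]
    by (simp add: v2 [symmetric] power2_eq_square)
  have "q1 \<noteq> 0"
    using Re_mult_coth_ge(1) [OF v1] q1 by auto
  have "1 + \<xi> * q2 / q1 = 1 / 2 + (2 * q1 + 4 * \<xi> * q2) / (4 * q1)"
    using \<open>q1 \<noteq> 0\<close> by (simp add: field_simps)
  also have "\<dots> = 1 / 2 + v * cosh v / sinh v / 2"
    unfolding q2 q1 [symmetric] using \<open>v \<noteq> 0\<close> by simp
  finally have "Re (1 + \<xi> * q2 / q1) = 1 / 2 + Re (v * cosh v / sinh v) / 2"
    by (simp only: plus_complex.sel Re_divide_numeral one_complex.sel)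
  with Re_mult_coth_ge(2) [OF v1]
  show "(1 + cot 1) / 2 \<le> Re (1 + \<xi> * deriv (deriv cosh_sqrt) \<xi> / deriv cosh_sqrt \<xi>)"
    by (simp add: q1_def q2_def)
qed

text \<open>If p left the image of \<D>, the point from \<open>Miller_Mocanu\<close> (with
  \<open>R\<close> = 9) would meet the admissibility conditions, so \<psi> would take a value
  outside \<Omega> there.\<close>

lemma admissible_imp_subordinate:
  assumes "p \<in> \<H>\<^sub>1" and adm: "\<psi> \<in> admissible \<Omega>"
    and mem: "\<And>z. z \<in> \<D> \<Longrightarrow> \<psi> (p z) (z * deriv p z) (z\<^sup>2 * deriv (deriv p) z) z \<in> \<Omega>"
  shows "p \<prec>\<^sub>\<D> cosh_sqrt"
proof (rule subordinate_univalentI)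
  show p: "p holomorphic_on \<D>" and p0: "p 0 = cosh_sqrt 0"
    using \<open>p \<in> \<H>\<^sub>1\<close> by (auto simp: \<H>\<^sub>1_iff cosh_sqrt_eq)
  show "cosh_sqrt holomorphic_on \<D>"
    by (rule cosh_sqrt_holomorphic)
  show "inj_on cosh_sqrt \<D>"
    by (rule inj_on_subset [OF cosh_sqrt_inj]) auto
  show "p ` \<D> \<subseteq> cosh_sqrt ` \<D>"
  proof (rule ccontr)
    assume "\<not> p ` \<D> \<subseteq> cosh_sqrt ` \<D>"
    then obtain z0 \<xi> and m :: real where *: "z0 \<in> \<D>" "cmod \<xi> = 1" "m \<ge> 1" "p z0 = cosh_sqrt \<xi>"
        "z0 * deriv p z0 = of_real m * \<xi> * deriv cosh_sqrt \<xi>"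
        "Re (1 + z0\<^sup>2 * deriv (deriv p) z0 / (z0 * deriv p z0)) \<ge>
          m * Re (1 + \<xi> * deriv (deriv cosh_sqrt) \<xi> / deriv cosh_sqrt \<xi>)"
      by (rule Miller_Mocanu [OF cosh_sqrt_holomorphic cosh_sqrt_inj _ p p0, rotated]) auto
    have "z0 * deriv p z0 = of_real (m / 2) * csqrt \<xi> * sinh (csqrt \<xi>)"
      using *(5) cosh_sqrt_convexity(1) [OF *(2)] by (simp add: mult.assoc)
    moreover have "m / 2 * (1 + cot 1) \<le> Re (1 + z0\<^sup>2 * deriv (deriv p) z0 / (z0 * deriv p z0))"
      using order_trans [OF mult_left_mono [OF cosh_sqrt_convexity(2) [OF *(2)], of m] *(6)] *(3)
      by simp
    ultimately have "\<psi> (p z0) (z0 * deriv p z0) (z0\<^sup>2 * deriv (deriv p) z0) z0 \<notin> \<Omega>"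
      using adm *(1-4) unfolding admissible_def by blast
    with mem [OF *(1)] show False
      by contradiction
  qed
qed

theorem theorem4p4:
  fixes p :: "complex \<Rightarrow> complex"
  assumes "p \<in> \<H>\<^sub>1"
  shows "(\<forall>\<Omega> \<psi>. \<Omega> \<noteq> UNIV \<longrightarrow> \<psi> \<in> admissible \<Omega> \<longrightarrow>
            (\<forall>z\<in>\<D>. \<psi> (p z) (z * deriv p z) (z\<^sup>2 * deriv (deriv p) z) z \<in> \<Omega>) \<longrightarrow>
            p \<prec>\<^sub>\<D> cosh_sqrt) \<and>
         (\<forall>\<psi>. \<psi> \<in> admissible \<Omega>\<^sub>\<rho> \<longrightarrow>
            (\<lambda>z. \<psi> (p z) (z * deriv p z) (z\<^sup>2 * deriv (deriv p) z) z) \<prec>\<^sub>\<D> cosh_sqrt \<longrightarrow>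
            p \<prec>\<^sub>\<D> cosh_sqrt)"
proof (intro conjI allI impI)
  fix \<Omega> \<psi>
  assume "\<psi> \<in> admissible \<Omega>"
    "\<forall>z\<in>\<D>. \<psi> (p z) (z * deriv p z) (z\<^sup>2 * deriv (deriv p) z) z \<in> \<Omega>"
  thus "p \<prec>\<^sub>\<D> cosh_sqrt"
    using admissible_imp_subordinate [OF assms] by blast
next
  fix \<psi>
  assume adm: "\<psi> \<in> admissible \<Omega>\<^sub>\<rho>"
    and sub: "(\<lambda>z. \<psi> (p z) (z * deriv p z) (z\<^sup>2 * deriv (deriv p) z) z) \<prec>\<^sub>\<D> cosh_sqrt"
  \<comment> \<open>Subordination places the values in the image of \<D> under
    \<open>cosh_sqrt\<close>, which is \<open>\<Omega>\<^sub>\<rho>\<close>; this reduces (ii) to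
    the argument for (i).\<close>
  from sub have "\<psi> (p z) (z * deriv p z) (z\<^sup>2 * deriv (deriv p) z) z \<in> \<Omega>\<^sub>\<rho>" if "z \<in> \<D>" for z
    using that unfolding subordinate_def \<Omega>\<^sub>\<rho>_eq_image by blast
  with adm show "p \<prec>\<^sub>\<D> cosh_sqrt"
    using admissible_imp_subordinate [OF assms] by blast
qed

end
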